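(* If all agents $i\in[n]$ have submodular valuation functions (normalized so that $\mathrm{MMS}_i=1$) and follow their respective safe strategies $\mathcal{S}_i$, then (for suitable choices of the parameters $c$ and $k$) the Single-or-Sample algorithm is $\left(\frac1{24},\,0.423\right)$-competitive: with probability at least $0.423$, every agent $i\in[n]$ simultaneously receives a bundle $A_i$ with $v_i(A_i)\ge\frac1{24}\mathrm{MMS}_i$.
   Context: Setting: $n$ agents arrive in order $1,\dots,n$; agent $i$ has a monotone valuation $v_i:2^{[m]}\to\mathbb{R}_+$ over $m$ indivisible goods, fixed by an oblivious adversary; $\mathrm{MMS}_i=\max_{(P_1,\dots,P_n)}\min_\ell v_i(P_\ell)$ over partitions of $[m]$ into $n$ bundles. Single-or-Sample algorithm with parameter $k$: set $R_1=[m]$, $t=0$. For $i=1,\dots,n$: agent $i$ observes the remaining set $R_i$ and chooses one of two actions. (Special round) She selects an item $e\in R_i$, receives $\{e\}$; set $R_{i+1}=R_i\setminus\{e\}$ and $t\leftarrow t+1$. (Non-special round) Set $G=R_i$, $j=1$. While $|G|\ge k(n-t)$: agent $i$ specifies a bucket $B_{ij}\subseteq G$ with $|B_{ij}|=k(n-t)$ (possibly depending on earlier draws); an item $e_{ij}$ is picked uniformly at random from $B_{ij}$; set $G\leftarrow G\setminus B_{ij}$, $j\leftarrow j+1$. Agent $i$ receives $A_i=\bigcup_j\{e_{ij}\}$ and $R_{i+1}=R_i\setminus A_i$. Safe strategy $\mathcal{S}_i$ with parameter $c$, with $\tau=\frac{1}{ck}$: if $R_i$ contains an item $e$ with $v_i(\{e\})\ge\tau$,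 agent $i$ chooses a special round and selects an item of maximum singleton value in $R_i$. Otherwise she chooses the non-special round, and in step $j$ takes $B_{ij}$ to be the $k(n-t)$ items $e$ of $G$ with the largest marginal values $v_i(A_i^{j-1}\cup\{e\})-v_i(A_i^{j-1})$, where $A_i^{j-1}=\{e_{ij'}:j'<j\}$. *)

theory Defs
  imports "HOL-Probability.Probability_Mass_Function"
begin

text \<open>Goods are the natural numbers \<open>1, \<dots>, m\<close> and agents the natural numbers \<open>1, \<dots>, n\<close>.
  A valuation is only constrained on subsets of \<open>{1..m}\<close>.\<close>

definition monotone_valuation :: "nat \<Rightarrow> (nat set \<Rightarrow> real) \<Rightarrow> bool" where
  "monotone_valuation m v \<longleftrightarrow>
     (\<forall>S\<subseteq>{1..m}. 0 \<le> v S) \<and> (\<forall>S T. S \<subseteq> T \<and> T \<subseteq> {1..m} \<longrightarrow> v S \<le> v T)"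

definition submodular_valuation :: "nat \<Rightarrow> (nat set \<Rightarrow> real) \<Rightarrow> bool" where
  "submodular_valuation m v \<longleftrightarrow>
     (\<forall>S\<subseteq>{1..m}. \<forall>T\<subseteq>{1..m}. v (S \<union> T) + v (S \<inter> T) \<le> v S + v T)"

text \<open>Bundles of a partition may be empty.\<close>

definition bundle_partition :: "nat \<Rightarrow> nat \<Rightarrow> (nat \<Rightarrow> nat set) \<Rightarrow> bool" where
  "bundle_partition n m P \<longleftrightarrow> disjoint_family_on P {1..n} \<and> (\<Union>l\<in>{1..n}. P l) = {1..m}"

definition MMS :: "nat \<Rightarrow> nat \<Rightarrow> (nat set \<Rightarrow> real) \<Rightarrow> real" where
  "MMS n m v = Max {Min ((\<lambda>l. v (P l)) ` {1..n}) | P. bundle_partition n m P}"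

text \<open>In a non-special round, the bucket rule maps the current pool \<open>G\<close> and the list of items
  drawn so far in this round (in order) to the next bucket.  A strategy maps the remaining set
  \<open>R\<close> and the number \<open>t\<close> of special rounds so far to an action.\<close>

type_synonym bucket_rule = "nat set \<Rightarrow> nat list \<Rightarrow> nat set"

datatype action = Special nat | Non_Special bucket_rule

type_synonym strategy = "nat set \<Rightarrow> nat \<Rightarrow> action"

text \<open>The sampling loop with bucket size \<open>b\<close>, returning the list of drawn items.  The tests other
  than \<open>b \<le> card G\<close> only serve to make the function total: they always hold when \<open>b\<close> is positive,
  \<open>G\<close> is finite and the bucket rule returns a subset of \<open>G\<close> of size \<open>b\<close>.\<close>

function sample_round :: "nat \<Rightarrow> bucket_rule \<Rightarrow> nat set \<Rightarrow> nat list \<Rightarrow> nat list pmf" where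
  "sample_round b \<beta> G es =
     (if b \<le> card G \<and> 0 < b \<and> finite G \<and> \<beta> G es \<subseteq> G \<and> card (\<beta> G es) = b
      then do {
        e \<leftarrow> pmf_of_set (\<beta> G es);
        sample_round b \<beta> (G - \<beta> G es) (es @ [e])
      }
      else return_pmf es)"
  by pat_completeness auto
termination
proof (relation "Wellfounded.measure (\<lambda>(b, \<beta>, G, es). card G)", goal_cases)
  case 1
  show ?case by simp
next
  case (2 b \<beta> G es x)
  then have "card (G - \<beta> G es) = card G - b"
    by (metis card_Diff_subset finite_subset)
  with 2 show ?case by simp
qed

declare sample_round.simps [simp del]

text \<open>The joint distribution, after the first \<open>i\<close> rounds, of the allocation, the remaining set and
  the number of special rounds.\<close>

primrec sos_rounds ::
  "nat \<Rightarrow> nat \<Rightarrow> nat \<Rightarrow> (nat \<Rightarrow> strategy) \<Rightarrow> nat \<Rightarrow> ((nat \<Rightarrow> nat set) \<times> nat set \<times> nat) pmf" where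
  "sos_rounds k n m \<sigma> 0 = return_pmf (\<lambda>_. {}, {1..m}, 0)"
| "sos_rounds k n m \<sigma> (Suc i) = do {
     (A, R, t) \<leftarrow> sos_rounds k n m \<sigma> i;
     (case \<sigma> (Suc i) R t of
        Special e \<Rightarrow> return_pmf (A(Suc i := {e}), R - {e}, t + 1)
      | Non_Special \<beta> \<Rightarrow> do {
          es \<leftarrow> sample_round (k * (n - t)) \<beta> R [];
          return_pmf (A(Suc i := set es), R - set es, t)
        })
   }"

definition single_or_sample ::
  "nat \<Rightarrow> nat \<Rightarrow> nat \<Rightarrow> (nat \<Rightarrow> strategy) \<Rightarrow> (nat \<Rightarrow> nat set) pmf" where
  "single_or_sample k n m \<sigma> = map_pmf fst (sos_rounds k n m \<sigma> n)"

definition marginal :: "(nat set \<Rightarrow> real) \<Rightarrow> nat set \<Rightarrow> nat \<Rightarrow> real" where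
  "marginal v S e = v (S \<union> {e}) - v S"

definition top_bucket :: "(nat set \<Rightarrow> real) \<Rightarrow> nat \<Rightarrow> nat set \<Rightarrow> nat set \<Rightarrow> nat set \<Rightarrow> bool" where
  "top_bucket v b G S B \<longleftrightarrow>
     B \<subseteq> G \<and> card B = b \<and> (\<forall>e\<in>B. \<forall>f\<in>G - B. marginal v S f \<le> marginal v S e)"

text \<open>A predicate rather than a function, since ties (among items of maximum singleton value, and
  at the boundary of a bucket) may be broken arbitrarily, also depending on the observed state.\<close>

definition safe_strategy ::
  "real \<Rightarrow> nat \<Rightarrow> nat \<Rightarrow> nat \<Rightarrow> (nat set \<Rightarrow> real) \<Rightarrow> strategy \<Rightarrow> bool" where
  "safe_strategy c k n m v s \<longleftrightarrow>
     (\<forall>R\<subseteq>{1..m}. \<forall>t<n.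
        if \<exists>e\<in>R. 1 / (c * real k) \<le> v {e}
        then \<exists>e\<in>R. s R t = Special e \<and> (\<forall>f\<in>R. v {f} \<le> v {e})
        else \<exists>\<beta>. s R t = Non_Special \<beta> \<and>
               (\<forall>G es. G \<subseteq> R \<and> set es \<subseteq> R - G \<and> k * (n - t) \<le> card G \<longrightarrow>
                  top_bucket v (k * (n - t)) G (set es) (\<beta> G es)))"

text \<open>\<open>D\<close> is the distribution of the allocation produced by the algorithm.\<close>

definition competitive ::
  "real \<Rightarrow> real \<Rightarrow> nat \<Rightarrow> nat \<Rightarrow> (nat \<Rightarrow> nat set \<Rightarrow> real) \<Rightarrow> (nat \<Rightarrow> nat set) pmf \<Rightarrow> bool" where
  "competitive \<alpha> p n m v D \<longleftrightarrow>
     p \<le> measure_pmf.prob D {A. \<forall>i\<in>{1..n}. \<alpha> * MMS n m (v i) \<le> v i (A i)}"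

end

theory Submission
  imports Defs "HOL-Analysis.Complex_Transcendental"
begin

text \<open>The parameters are \<open>k = 4\<close> and \<open>c = 6\<close>, so \<open>\<tau> = 1/24\<close>, and special rounds always succeed.
  In a non-special round with remaining set \<open>R\<close> the greedy buckets guarantee, for every outcome of
  the draws, \<open>\<Sum>f\<in>R. marginal v A f \<le> 4 (n - t) (\<tau> + v A)\<close>.  Hence \<open>v A \<ge> 1/24\<close> as soon as
  some \<open>n - t\<close> bundles of an MMS partition retain \<open>3/8\<close> of their value on average.

  Fix an agent, charge her bundles additively for removed items (at most 1 per bundle), and let \<open>L\<close>
  be the least total charge of \<open>n - t\<close> bundles.  A special round does not increase \<open>L\<close>; a
  non-special round increases it by at most \<open>1/4\<close> in expectation, and since \<open>exp 8 \<le> 5 ^ 5\<close>,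
  \<open>5 powr (L - 5/8 q)\<close> is a supermartingale, where \<open>q\<close> is the number of non-special rounds
  so far.  Agent \<open>i\<close> can fail only if \<open>L > 5/8 (n - t)\<close>, where \<open>n - t = q + (n - i + 1)\<close>, so
  she fails with probability at most \<open>5 powr (- 5/8 (n - i + 1))\<close>.  These bounds sum to less than
  \<open>0.577\<close>.\<close>

section \<open>Greedy buckets\<close>

lemma marginal_nonneg:
  assumes "monotone_valuation m v" "S \<subseteq> {1..m}" "e \<in> {1..m}"
  shows "0 \<le> marginal v S e"
proof -
  have "S \<union> {e} \<subseteq> {1..m}" "S \<subseteq> S \<union> {e}" using assms by auto
  then show ?thesis
    using assms(1) unfolding monotone_valuation_def marginal_def by fastforce
qed

lemma marginal_antimono:
  assumes mono: "monotone_valuation m v" and submod: "submodular_valuation m v"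
    and "S \<subseteq> T" "T \<subseteq> {1..m}" "e \<in> {1..m}"
  shows "marginal v T e \<le> marginal v S e"
proof (cases "e \<in> T")
  case True
  then have "marginal v T e = 0" by (simp add: marginal_def insert_absorb)
  then show ?thesis using marginal_nonneg[OF mono, of S e] assms by auto
next
  case False
  have *: "(S \<union> {e}) \<union> T = T \<union> {e}" "(S \<union> {e}) \<inter> T = S" using assms False by auto
  have "S \<union> {e} \<subseteq> {1..m}" using assms by auto
  then have "v ((S \<union> {e}) \<union> T) + v ((S \<union> {e}) \<inter> T) \<le> v (S \<union> {e}) + v T"
    using submod assms(4) unfolding submodular_valuation_def by blast
  then show ?thesis unfolding * marginal_def by simp
qed

lemma valuation_Un_le_sum_marginal:
  assumes mono: "monotone_valuation m v" and submod: "submodular_valuation m v"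
    and "finite F" "F \<subseteq> {1..m}" "S \<subseteq> {1..m}"
  shows "v (S \<union> F) \<le> v S + (\<Sum>e\<in>F. marginal v S e)"
  using assms(3,4)
proof (induction F rule: finite_induct)
  case empty
  then show ?case by simp
next
  case (insert x F)
  have "marginal v (S \<union> F) x \<le> marginal v S x"
    by (rule marginal_antimono[OF mono submod]) (use insert assms in auto)
  with insert show ?case by (simp add: marginal_def)
qed

lemma set_sample_round_mono:
  "es' \<in> set_pmf (sample_round b \<beta> G es) \<Longrightarrow> set es \<subseteq> set es'"
proof (induction b \<beta> G es rule: sample_round.induct)
  case (1 b \<beta> G es)
  show ?case
  proof (cases "b \<le> card G \<and> 0 < b \<and> finite G \<and> \<beta> G es \<subseteq> G \<and> card (\<beta> G es) = b")
    case True
    then obtain e where "es' \<in> set_pmf (sample_round b \<beta> (G - \<beta> G es) (es @ [e]))"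
      "e \<in> set_pmf (pmf_of_set (\<beta> G es))"
      using "1.prems" by (subst (asm) sample_round.simps) auto
    with "1.IH"[OF True] show ?thesis by auto
  next
    case False
    then have "sample_round b \<beta> G es = return_pmf es"
      by (subst sample_round.simps) (rule if_not_P)
    then show ?thesis using "1.prems" by simp
  qed
qed

lemma set_sample_round_subset:
  "es' \<in> set_pmf (sample_round b \<beta> G es) \<Longrightarrow> set es' \<subseteq> set es \<union> G"
proof (induction b \<beta> G es rule: sample_round.induct)
  case (1 b \<beta> G es)
  show ?case
  proof (cases "b \<le> card G \<and> 0 < b \<and> finite G \<and> \<beta> G es \<subseteq> G \<and> card (\<beta> G es) = b")
    case True
    then have ne: "\<beta> G es \<noteq> {}" "finite (\<beta> G es)" by (auto intro: finite_subset)
    then obtain e where "es' \<in> set_pmf (sample_round b \<beta> (G - \<beta> G es) (es @ [e]))"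
      "e \<in> \<beta> G es"
      using "1.prems" True by (subst (asm) sample_round.simps) (auto simp: set_pmf_of_set)
    with "1.IH"[OF True, of e] ne True show ?thesis by (auto simp: set_pmf_of_set)
  next
    case False
    then have "sample_round b \<beta> G es = return_pmf es"
      by (subst sample_round.simps) (rule if_not_P)
    then show ?thesis using "1.prems" by simp
  qed
qed

text \<open>Every item of a bucket has at most the marginal of the item drawn from the preceding bucket;
  \<open>M\<close> plays the role of that item for the first bucket.  Hence this lower bound on the value
  received holds for every outcome of the draws.\<close>

lemma sample_round_sum_marginal_le:
  assumes mono: "monotone_valuation m v" and submod: "submodular_valuation m v"
    and b: "0 < b" and R: "R \<subseteq> {1..m}"
    and rule: "\<And>G es. G \<subseteq> R \<Longrightarrow> set es \<subseteq> R - G \<Longrightarrow> b \<le> card G \<Longrightarrow> top_bucket v b G (set es) (\<beta> G es)"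
  shows "es' \<in> set_pmf (sample_round b \<beta> G es) \<Longrightarrow> G \<subseteq> R \<Longrightarrow> set es \<subseteq> R - G \<Longrightarrow> 0 \<le> M \<Longrightarrow>
    (\<And>f. f \<in> G \<Longrightarrow> marginal v (set es) f \<le> M) \<Longrightarrow>
    (\<Sum>f\<in>G. marginal v (set es') f) \<le> real b * (M + v (set es') - v (set es))"
  using b rule
proof (induction b \<beta> G es arbitrary: M rule: sample_round.induct)
  case (1 b \<beta> G es)
  have fin: "finite G" using "1.prems"(2) R by (meson finite_atLeastAtMost finite_subset)
  show ?case
  proof (cases "b \<le> card G")
    case True
    let ?B = "\<beta> G es"
    have top: "top_bucket v b G (set es) ?B" using "1.prems" True by blast
    then have B: "?B \<subseteq> G" "card ?B = b" by (auto simp: top_bucket_def)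
    with fin True "1.prems" have
      cond: "b \<le> card G \<and> 0 < b \<and> finite G \<and> ?B \<subseteq> G \<and> card ?B = b" by auto
    then have ne: "?B \<noteq> {}" "finite ?B" by (auto intro: finite_subset)
    with cond "1.prems"(1) obtain e where e: "e \<in> ?B"
      and es': "es' \<in> set_pmf (sample_round b \<beta> (G - ?B) (es @ [e]))"
      by (subst (asm) sample_round.simps) (auto simp: set_pmf_of_set)
    have eG: "e \<in> G" using e B by auto
    have sub: "insert e (set es) \<subseteq> {1..m}" using eG R "1.prems" by auto
    have es_sub: "insert e (set es) \<subseteq> set es'" using set_sample_round_mono[OF es'] by auto
    have es'_sub: "set es' \<subseteq> {1..m}"
      using set_sample_round_subset[OF es'] sub subset_trans[OF "1.prems"(2) R] by auto
    let ?M = "marginal v (set es) e"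
    have M0: "0 \<le> ?M" by (rule marginal_nonneg[OF mono]) (use sub in auto)
    have M1: "marginal v (set (es @ [e])) f \<le> ?M" if "f \<in> G - ?B" for f
    proof -
      have "marginal v (set (es @ [e])) f \<le> marginal v (set es) f"
        by (rule marginal_antimono[OF mono submod]) (use sub that R "1.prems" in auto)
      also have "\<dots> \<le> ?M" using top e that by (auto simp: top_bucket_def)
      finally show ?thesis .
    qed
    have eset: "e \<in> set_pmf (pmf_of_set ?B)" using ne e by (simp add: set_pmf_of_set)
    have rest: "(\<Sum>f\<in>G - ?B. marginal v (set es') f)
        \<le> real b * (?M + v (set es') - v (set (es @ [e])))"
      by (rule "1.IH"[OF cond eset es' _ _ M0 M1]) (use "1.prems" eG e R in auto)
    have "(\<Sum>f\<in>?B. marginal v (set es') f) \<le> (\<Sum>f\<in>?B. M)"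
    proof (rule sum_mono)
      fix f assume "f \<in> ?B"
      then have f: "f \<in> G" using B by auto
      have "marginal v (set es') f \<le> marginal v (set es) f"
        by (rule marginal_antimono[OF mono submod]) (use es_sub es'_sub f R "1.prems" in auto)
      also have "\<dots> \<le> M" using "1.prems" f by auto
      finally show "marginal v (set es') f \<le> M" .
    qed
    also have "\<dots> = real b * M" using B by simp
    finally have "(\<Sum>f\<in>?B. marginal v (set es') f) \<le> real b * M" .
    moreover have "(\<Sum>f\<in>G. marginal v (set es') f)
        = (\<Sum>f\<in>G - ?B. marginal v (set es') f) + (\<Sum>f\<in>?B. marginal v (set es') f)"
      using sum.subset_diff[OF B(1) fin] .
    \<comment> \<open>The marginal of the drawn item is exactly its gain in value, so it cancels and
      the bounds of successive buckets telescope.\<close>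
    moreover have "?M + v (set es') - v (set (es @ [e])) = v (set es') - v (set es)"
      by (simp add: marginal_def)
    note rest[unfolded this]
    ultimately have "(\<Sum>f\<in>G. marginal v (set es') f)
        \<le> real b * (v (set es') - v (set es)) + real b * M"
      by linarith
    then show ?thesis by (simp add: algebra_simps)
  next
    case False
    then have es': "es' = es" using "1.prems"(1) by (subst (asm) sample_round.simps) simp
    \<comment> \<open>Fewer than \<open>b\<close> items are left over, each with marginal at most
      \<open>M\<close>.\<close>
    have "(\<Sum>f\<in>G. marginal v (set es') f) \<le> (\<Sum>f\<in>G. M)"
      unfolding es' by (rule sum_mono) (use "1.prems" in auto)
    also have "\<dots> \<le> real b * M" using False "1.prems" by (simp add: mult_right_mono)
    finally show ?thesis using es' by simp
  qed
qed

section \<open>Exponential moments of the sampling loop\<close>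

text \<open>Convexity puts \<open>exp\<close> below its chord between \<open>0\<close> and
  \<open>l\<close>. The bound is affine in the weight, so it can be averaged over a bucket.\<close>

lemma exp_mult_le_chord:
  fixes l w :: real
  assumes "0 \<le> w" "w \<le> 1"
  shows "exp (l * w) \<le> 1 + (exp l - 1) * w"
proof -
  have "exp ((1 - w) *\<^sub>R 0 + w *\<^sub>R l) \<le> (1 - w) * exp 0 + w * exp l"
    by (rule convex_onD[OF exp_convex]) (use assms in auto)
  then show ?thesis by (simp add: algebra_simps)
qed

lemma sum_set_le_sum_list:
  fixes w :: "'a \<Rightarrow> real"
  assumes "\<And>e. 0 \<le> w e"
  shows "sum w (set es) \<le> sum_list (map w es)"
  using assms by (induction es) (auto simp: sum.insert_if add_increasing)

text \<open>A uniform draw from a bucket \<open>B\<close> multiplies the moment by the mean of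
  \<open>exp (l * w e)\<close>. By the chord bound this is at most
  \<open>1 + (exp l - 1) / b * sum w B\<close>, hence at most
  \<open>exp ((exp l - 1) / b * sum w B)\<close>. Buckets are disjoint, so the exponents add up
  within \<open>sum w G\<close>, however the buckets depend on earlier draws.\<close>

lemma nn_integral_sample_round_le:
  fixes w :: "nat \<Rightarrow> real" and l :: real
  assumes w: "\<And>e. 0 \<le> w e" "\<And>e. w e \<le> 1" and l: "0 \<le> l"
  shows "(\<integral>\<^sup>+ xs. ennreal (exp (l * sum_list (map w xs))) \<partial>measure_pmf (sample_round b \<beta> G es))
    \<le> ennreal (exp (l * sum_list (map w es) + (exp l - 1) / real b * sum w G))"
proof (induction b \<beta> G es rule: sample_round.induct)
  case (1 b \<beta> G es)
  have l1: "1 \<le> exp l" using l by simp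
  show ?case
  proof (cases "b \<le> card G \<and> 0 < b \<and> finite G \<and> \<beta> G es \<subseteq> G \<and> card (\<beta> G es) = b")
    case True
    let ?B = "\<beta> G es"
    let ?r = "(exp l - 1) / real b"
    let ?D = "exp (l * sum_list (map w es) + ?r * sum w (G - ?B))"
    from True have ne: "?B \<noteq> {}" "finite ?B" by (auto intro: finite_subset)
    have "(\<integral>\<^sup>+ xs. ennreal (exp (l * sum_list (map w xs))) \<partial>measure_pmf (sample_round b \<beta> G es))
       = (\<integral>\<^sup>+ e. (\<integral>\<^sup>+ xs. ennreal (exp (l * sum_list (map w xs)))
            \<partial>measure_pmf (sample_round b \<beta> (G - ?B) (es @ [e]))) \<partial>measure_pmf (pmf_of_set ?B))"
      using True by (subst sample_round.simps) simp
    also have "\<dots> \<le> (\<integral>\<^sup>+ e. ennreal (exp (l * sum_list (map w (es @ [e])) + ?r * sum w (G - ?B)))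
        \<partial>measure_pmf (pmf_of_set ?B))"
      by (rule nn_integral_mono_AE) (use "1.IH"[OF True] in \<open>simp add: AE_measure_pmf_iff\<close>)
    also have "\<dots> = (\<Sum>e\<in>?B. ennreal (?D * exp (l * w e))) / ennreal (real b)"
      using True ne
      by (subst nn_integral_pmf_of_set)
        (auto simp: ennreal_of_nat_eq_real_of_nat algebra_simps exp_add)
    also have "\<dots> = ennreal ((\<Sum>e\<in>?B. ?D * exp (l * w e)) / real b)"
      using True by (subst sum_ennreal) (auto simp: divide_ennreal sum_nonneg)
    also have "\<dots> \<le> ennreal (?D * exp (?r * sum w ?B))"
    proof (rule ennreal_leI)
      have "(\<Sum>e\<in>?B. exp (l * w e)) \<le> (\<Sum>e\<in>?B. 1 + (exp l - 1) * w e)"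
        by (intro sum_mono exp_mult_le_chord w)
      also have "\<dots> = real b + (exp l - 1) * sum w ?B"
        using True by (simp add: sum.distrib sum_distrib_left)
      finally have "(\<Sum>e\<in>?B. exp (l * w e)) / real b \<le> (real b + (exp l - 1) * sum w ?B) / real b"
        by (simp add: divide_right_mono)
      also have "\<dots> = 1 + ?r * sum w ?B" using True by (simp add: field_simps)
      also have "\<dots> \<le> exp (?r * sum w ?B)" by (rule exp_ge_add_one_self)
      finally have "?D * ((\<Sum>e\<in>?B. exp (l * w e)) / real b) \<le> ?D * exp (?r * sum w ?B)"
        by (intro mult_left_mono) auto
      then show "(\<Sum>e\<in>?B. ?D * exp (l * w e)) / real b \<le> ?D * exp (?r * sum w ?B)"
        by (simp add: sum_distrib_left)
    qed
    also have "?D * exp (?r * sum w ?B) = exp (l * sum_list (map w es) + ?r * sum w G)"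
      using True by (subst sum.subset_diff[of ?B G]) (auto simp: exp_add[symmetric] algebra_simps)
    finally show ?thesis .
  next
    case False
    \<comment> \<open>Leftover items only enlarge the exponent on the right.\<close>
    have "0 \<le> (exp l - 1) / real b * sum w G"
      using l1 w by (intro mult_nonneg_nonneg sum_nonneg divide_nonneg_nonneg) auto
    with False show ?thesis by (subst sample_round.simps) (auto intro!: ennreal_leI)
  qed
qed

section \<open>Additive charges for a maximin partition\<close>

lemma MMS_attained:
  assumes "1 \<le> n"
  obtains P where "bundle_partition n m P" "\<And>l. l \<in> {1..n} \<Longrightarrow> MMS n m v \<le> v (P l)"
proof -
  let ?A = "{Min ((\<lambda>l. v (P l)) ` {1..n}) | P. bundle_partition n m P}"
  \<comment> \<open>Infinitely many \<open>P\<close> qualify, as their values outside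
    \<open>{1..n}\<close> are free. Finiteness comes from the minima being values of
    \<open>v\<close> on subsets of \<open>{1..m}\<close>.\<close>
  have "?A \<subseteq> v ` Pow {1..m}"
  proof
    fix x assume "x \<in> ?A"
    then obtain P where P: "bundle_partition n m P" "x = Min ((\<lambda>l. v (P l)) ` {1..n})" by blast
    have "x \<in> (\<lambda>l. v (P l)) ` {1..n}" unfolding P(2) by (rule Min_in) (use assms in auto)
    with P(1) show "x \<in> v ` Pow {1..m}" unfolding bundle_partition_def by blast
  qed
  then have fin: "finite ?A" by (rule finite_subset) auto
  have "bundle_partition n m (\<lambda>l. if l = 1 then {1..m} else {})"
    using assms by (auto simp: bundle_partition_def disjoint_family_on_def)
  then have "?A \<noteq> {}" by blast
  then have "MMS n m v \<in> ?A" unfolding MMS_def by (rule Max_in[OF fin])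
  then obtain P where P: "bundle_partition n m P" "MMS n m v = Min ((\<lambda>l. v (P l)) ` {1..n})"
    by blast
  have "MMS n m v \<le> v (P l)" if "l \<in> {1..n}" for l
    unfolding P(2) by (rule Min_le) (use that in auto)
  with P(1) show ?thesis by (rule that)
qed

lemma prefix_Suc:
  fixes X :: "nat set"
  shows "{f\<in>X. f < Suc j} = (if j \<in> X then {f\<in>X. f < j} \<union> {j} else {f\<in>X. f < j})"
  by (auto simp: less_Suc_eq)

text \<open>Items are inserted in increasing order into \<open>X\<close> and \<open>Y\<close> in
  parallel. A kept item gains at least as much over the smaller prefix of \<open>Y\<close> as over
  that of \<open>X\<close>, so the gap grows only at deleted items, each time by the marginal over
  the prefix of \<open>X\<close>.\<close>

lemma valuation_diff_le_sum_prefix_marginal: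
  assumes mono: "monotone_valuation m v" and submod: "submodular_valuation m v"
    and X: "X \<subseteq> {1..m}" and Y: "Y \<subseteq> X"
  shows "v X - v Y \<le> (\<Sum>e\<in>X - Y. marginal v {f\<in>X. f < e} e)"
proof -
  let ?w = "\<lambda>e. marginal v {f\<in>X. f < e} e"
  have "v {f\<in>X. f < j} - v {f\<in>Y. f < j} \<le> (\<Sum>e\<in>{f\<in>X - Y. f < j}. ?w e)" for j
  proof (induction j)
    case 0
    then show ?case by simp
  next
    case (Suc j)
    consider "j \<notin> X" | "j \<in> Y" | "j \<in> X - Y" by blast
    then show ?case
    proof cases
      case 1
      then have "j \<notin> Y" "j \<notin> X - Y" using Y by auto
      with 1 Suc show ?thesis by (simp only: prefix_Suc if_False)
    next
      case 2
      then have j: "j \<in> X" "j \<notin> X - Y" using Y by auto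
      have "?w j \<le> marginal v {f\<in>Y. f < j} j"
        by (rule marginal_antimono[OF mono submod]) (use j X Y in auto)
      with Suc 2 j show ?thesis
        unfolding marginal_def by (simp only: prefix_Suc if_True if_False)
    next
      case 3
      then have j: "j \<in> X" "j \<notin> Y" by auto
      have "(\<Sum>e\<in>{f\<in>X - Y. f < j} \<union> {j}. ?w e) = (\<Sum>e\<in>{f\<in>X - Y. f < j}. ?w e) + ?w j"
        by (subst sum.union_disjoint) auto
      with Suc 3 j show ?thesis
        by (simp only: prefix_Suc if_True if_False) (simp add: marginal_def)
    qed
  qed
  \<comment> \<open>Prefixes are strict, so \<open>Suc m\<close> is the bound that covers all
    items.\<close>
  from this[of "Suc m"] have "v {f\<in>X. f < Suc m} - v {f\<in>Y. f < Suc m}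
     \<le> (\<Sum>e\<in>{f\<in>X - Y. f < Suc m}. ?w e)" .
  moreover have "{f\<in>X. f < Suc m} = X" "{f\<in>Y. f < Suc m} = Y" "{f\<in>X - Y. f < Suc m} = X - Y"
    using X Y by (auto simp: less_Suc_eq_le)
  ultimately show ?thesis by simp
qed

lemma sum_prefix_marginal:
  assumes X: "X \<subseteq> {1..m}"
  shows "(\<Sum>e\<in>X. marginal v {f\<in>X. f < e} e) = v X - v {}"
proof -
  let ?w = "\<lambda>e. marginal v {f\<in>X. f < e} e"
  have "(\<Sum>e\<in>{f\<in>X. f < j}. ?w e) = v {f\<in>X. f < j} - v {}" for j
  proof (induction j)
    case 0
    then show ?case by simp
  next
    case (Suc j)
    have "(\<Sum>e\<in>{f\<in>X. f < j} \<union> {j}. ?w e) = (\<Sum>e\<in>{f\<in>X. f < j}. ?w e) + ?w j"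
      by (subst sum.union_disjoint) auto
    with Suc show ?case by (cases "j \<in> X") (simp_all add: prefix_Suc marginal_def)
  qed
  from this[of "Suc m"] have "(\<Sum>e\<in>{f\<in>X. f < Suc m}. ?w e) = v {f\<in>X. f < Suc m} - v {}" .
  moreover have "{f\<in>X. f < Suc m} = X" using X by (auto simp: less_Suc_eq_le)
  ultimately show ?thesis by simp
qed

text \<open>The charge of an item is its marginal over the smaller items of \<open>X\<close>,
  divided by \<open>v X\<close>. The scaling caps the total at 1 and is harmless, because
  \<open>1 \<le> v X\<close> gives \<open>v Y / v X \<le> v Y\<close>.\<close>

lemma bundle_loss_weights:
  assumes mono: "monotone_valuation m v" and submod: "submodular_valuation m v"
    and X: "X \<subseteq> {1..m}" and vX: "1 \<le> v X"
  obtains \<delta> where "\<And>e. e \<in> X \<Longrightarrow> 0 \<le> \<delta> e" "sum \<delta> X \<le> 1"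
    "\<And>Y. Y \<subseteq> X \<Longrightarrow> 1 - sum \<delta> (X - Y) \<le> v Y"
proof
  let ?w = "\<lambda>e. marginal v {f\<in>X. f < e} e"
  let ?\<delta> = "\<lambda>e. ?w e / v X"
  show "0 \<le> ?\<delta> e" if "e \<in> X" for e
  proof (intro divide_nonneg_nonneg marginal_nonneg[OF mono])
    show "{f\<in>X. f < e} \<subseteq> {1..m}" "e \<in> {1..m}" "0 \<le> v X" using X that vX by auto
  qed
  have v0: "0 \<le> v Y" if "Y \<subseteq> X" for Y
    using mono that X unfolding monotone_valuation_def by auto
  have "sum ?\<delta> X = (v X - v {}) / v X"
    by (simp add: sum_divide_distrib[symmetric] sum_prefix_marginal[OF X])
  also have "\<dots> \<le> 1" using vX v0[of "{}"] by simp
  finally show "sum ?\<delta> X \<le> 1" .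
  show "1 - sum ?\<delta> (X - Y) \<le> v Y" if "Y \<subseteq> X" for Y
  proof -
    have "v X - v Y \<le> sum ?w (X - Y)"
      by (rule valuation_diff_le_sum_prefix_marginal[OF mono submod X that])
    then have "(v X - v Y) / v X \<le> sum ?w (X - Y) / v X"
      by (rule divide_right_mono) (use vX in simp)
    then have "1 - v Y / v X \<le> sum ?\<delta> (X - Y)"
      using vX by (simp add: diff_divide_distrib sum_divide_distrib)
    moreover have "v Y / v X \<le> v Y"
      using mult_left_mono[OF vX v0[OF that]] vX by (simp add: divide_le_eq)
    ultimately show ?thesis by simp
  qed
qed

text \<open>The supermartingale sees a valuation only through additive charges: \<open>own e\<close>
  is the bundle containing item \<open>e\<close>, and \<open>d e\<close> is the charge for removing
  it.\<close>

locale bundle_weights =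
  fixes n m :: nat and own :: "nat \<Rightarrow> nat" and d :: "nat \<Rightarrow> real"
  assumes weight_nonneg: "0 \<le> d e"
    and weight_le_1: "d e \<le> 1"
    and bundle_weight_le_1: "l \<in> {1..n} \<Longrightarrow> sum d {e\<in>{1..m}. own e = l} \<le> 1"

text \<open>Each bundle of an optimal partition gets its own charges; disjointness of the bundles
  lets them be glued into one function on items.\<close>

lemma MMS_bundle_weights:
  assumes n: "1 \<le> n" and mono: "monotone_valuation m v" and submod: "submodular_valuation m v"
    and MMS: "MMS n m v = 1"
  obtains own d where "bundle_weights n m own d"
    "\<And>l R. l \<in> {1..n} \<Longrightarrow> R \<subseteq> {1..m} \<Longrightarrow>
      1 - sum d {e\<in>{1..m} - R. own e = l} \<le> v {e\<in>R. own e = l}"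
proof -
  obtain P where P: "bundle_partition n m P" and vP: "\<And>l. l \<in> {1..n} \<Longrightarrow> 1 \<le> v (P l)"
    using MMS_attained[OF n, of m v] MMS by metis
  have Pm: "P l \<subseteq> {1..m}" if "l \<in> {1..n}" for l
    using P that unfolding bundle_partition_def by blast
  have "\<exists>\<delta>. (\<forall>e\<in>P l. 0 \<le> \<delta> e) \<and> sum \<delta> (P l) \<le> 1 \<and> (\<forall>Y\<subseteq>P l. 1 - sum \<delta> (P l - Y) \<le> v Y)"
    if "l \<in> {1..n}" for l
    using bundle_loss_weights[OF mono submod Pm[OF that] vP[OF that]] by metis
  then obtain \<delta> where \<delta>: "\<And>l e. l \<in> {1..n} \<Longrightarrow> e \<in> P l \<Longrightarrow> 0 \<le> \<delta> l e"
    "\<And>l. l \<in> {1..n} \<Longrightarrow> sum (\<delta> l) (P l) \<le> 1"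
    "\<And>l Y. l \<in> {1..n} \<Longrightarrow> Y \<subseteq> P l \<Longrightarrow> 1 - sum (\<delta> l) (P l - Y) \<le> v Y"
    by metis
  have "\<exists>l. l \<in> {1..n} \<and> e \<in> P l" if "e \<in> {1..m}" for e
    using P that unfolding bundle_partition_def by blast
  then obtain own where own: "\<And>e. e \<in> {1..m} \<Longrightarrow> own e \<in> {1..n} \<and> e \<in> P (own e)" by metis
  have own_iff: "own e = l \<longleftrightarrow> e \<in> P l" if "e \<in> {1..m}" "l \<in> {1..n}" for e l
  proof -
    have "P (own e) \<inter> P l = {}" if "own e \<noteq> l"
      using P own[OF \<open>e \<in> {1..m}\<close>] \<open>l \<in> {1..n}\<close> that
      unfolding bundle_partition_def disjoint_family_on_def by metis
    then show ?thesis using own[OF that(1)] by blast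
  qed
  \<comment> \<open>The charge is 0 outside \<open>{1..m}\<close>, since the locale bounds single
    charges on all naturals.\<close>
  define d where "d = (\<lambda>e. if e \<in> {1..m} then \<delta> (own e) e else 0)"
  have d_eq: "sum d S = sum (\<delta> l) S" if "l \<in> {1..n}" "S \<subseteq> P l" for l S
  proof (rule sum.cong)
    fix e assume "e \<in> S"
    then have "e \<in> P l" "e \<in> {1..m}" using that(2) Pm[OF that(1)] by blast+
    then show "d e = \<delta> l e" using own_iff[of e l] that unfolding d_def by simp
  qed simp
  have P_eq: "{e\<in>{1..m}. own e = l} = P l" if "l \<in> {1..n}" for l
    using own_iff[OF _ that] Pm[OF that] by blast
  have d0: "0 \<le> d e" for e unfolding d_def using \<delta>(1) own by simp
  show ?thesis
  proof (rule that)
    show "bundle_weights n m own d"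
    proof
      show "0 \<le> d e" for e by (rule d0)
      show bw: "sum d {e\<in>{1..m}. own e = l} \<le> 1" if "l \<in> {1..n}" for l
        using \<delta>(2)[OF that] d_eq[OF that subset_refl] P_eq[OF that] by simp
      show "d e \<le> 1" for e
      proof (cases "e \<in> {1..m}")
        case True
        then have "d e \<le> sum d {f\<in>{1..m}. own f = own e}"
          by (intro member_le_sum) (auto simp: d0)
        also have "\<dots> \<le> 1" using bw own True by blast
        finally show ?thesis .
      next
        case False
        then show ?thesis unfolding d_def by (simp only: if_False)
      qed
    qed
    fix l R assume l: "l \<in> {1..n}" and R: "R \<subseteq> {1..m}"
    have Y: "{e\<in>R. own e = l} \<subseteq> P l" using P_eq[OF l] R by blast
    have eq: "{e\<in>{1..m} - R. own e = l} = P l - {e\<in>R. own e = l}"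
      using P_eq[OF l] by blast
    show "1 - sum d {e\<in>{1..m} - R. own e = l} \<le> v {e\<in>R. own e = l}"
      unfolding eq using \<delta>(3)[OF l Y] d_eq[OF l Diff_subset] by simp
  qed
qed

section \<open>The least total charge of \<open>n - t\<close> bundles\<close>

context bundle_weights
begin

definition loss :: "nat set \<Rightarrow> nat set \<Rightarrow> real" where
  "loss H R = sum d {e\<in>{1..m} - R. own e \<in> H}"

text \<open>Minimising afresh in every state, instead of following one family, lets the family
  shrink whichever items the special rounds take. Its size \<open>n - t\<close> matches the bucket
  size \<open>4 * (n - t)\<close>.\<close>

definition min_loss :: "nat set \<Rightarrow> nat \<Rightarrow> real" where
  "min_loss R t = Min ((\<lambda>H. loss H R) ` {H. H \<subseteq> {1..n} \<and> card H = n - t})"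

lemma finite_candidates: "finite {H. H \<subseteq> {1..n} \<and> card H = n - t}"
  by (rule finite_subset[of _ "Pow {1..n}"]) auto

lemma min_loss_le: "H \<subseteq> {1..n} \<Longrightarrow> card H = n - t \<Longrightarrow> min_loss R t \<le> loss H R"
  unfolding min_loss_def using finite_candidates by (intro Min_le) auto

lemma min_loss_attained:
  obtains H where "H \<subseteq> {1..n}" "card H = n - t" "min_loss R t = loss H R"
proof -
  have "{H. H \<subseteq> {1..n} \<and> card H = n - t} \<noteq> {}"
    using obtain_subset_with_card_n[of "n - t" "{1..n}"] by auto
  then have "min_loss R t \<in> (\<lambda>H. loss H R) ` {H. H \<subseteq> {1..n} \<and> card H = n - t}"
    unfolding min_loss_def using finite_candidates by (intro Min_in) auto
  then show ?thesis using that by blast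
qed

lemma min_loss_initial: "min_loss {1..m} 0 \<le> 0"
  using min_loss_le[of "{1..n}" 0 "{1..m}"] by (simp add: loss_def)

text \<open>The bundle of the removed item is dropped from the minimising family.\<close>

lemma min_loss_remove:
  assumes "t < n"
  shows "min_loss (R - {e}) (t + 1) \<le> min_loss R t"
proof -
  obtain H where H: "H \<subseteq> {1..n}" "card H = n - t" "min_loss R t = loss H R"
    by (rule min_loss_attained)
  have "H \<noteq> {}" "finite H" using H assms by (auto intro: finite_subset)
  \<comment> \<open>If no bundle of \<open>H\<close> contains the item, any bundle may be dropped;
    \<open>t < n\<close> keeps \<open>H\<close> nonempty.\<close>
  then obtain l where l: "l \<in> H" "own e \<in> H \<Longrightarrow> own e = l" by blast
  have "min_loss (R - {e}) (t + 1) \<le> loss (H - {l}) (R - {e})"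
    using H l \<open>finite H\<close> by (intro min_loss_le) auto
  also have "\<dots> \<le> loss H R"
    unfolding loss_def by (rule sum_mono2) (use l weight_nonneg in auto)
  finally show ?thesis using H by simp
qed

lemma sum_weight_le_card:
  assumes "H \<subseteq> {1..n}"
  shows "sum d {e\<in>{1..m}. own e \<in> H} \<le> card H"
proof -
  have fin: "finite H" using assms by (rule finite_subset) simp
  have "{e\<in>{1..m}. own e \<in> H} = (\<Union>l\<in>H. {e\<in>{1..m}. own e = l})" by auto
  then have "sum d {e\<in>{1..m}. own e \<in> H} = (\<Sum>l\<in>H. sum d {e\<in>{1..m}. own e = l})"
    using fin by (simp only:) (rule sum.UNION_disjoint, auto)
  also have "\<dots> \<le> (\<Sum>l\<in>H. 1)"
    by (rule sum_mono) (use assms bundle_weight_le_1 in auto)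
  finally show ?thesis by simp
qed

text \<open>Entries that repeat or lie outside \<open>R\<close> are counted too, hence only an
  inequality. The list form is the one whose exponential moment is bounded above.\<close>

lemma loss_diff_le:
  "loss H (R - set es) \<le>
     loss H R + sum_list (map (\<lambda>e. if e \<in> {1..m} \<and> own e \<in> H then d e else 0) es)"
proof -
  let ?w = "\<lambda>e. if e \<in> {1..m} \<and> own e \<in> H then d e else 0"
  let ?A = "{e\<in>{1..m} - R. own e \<in> H}" and ?B = "{e\<in>set es. e \<in> {1..m} \<and> own e \<in> H}"
  have "loss H (R - set es) \<le> sum d (?A \<union> ?B)"
    unfolding loss_def by (rule sum_mono2) (use weight_nonneg in auto)
  also have "\<dots> \<le> sum d ?A + sum d ?B"
    using weight_nonneg by (subst sum_Un) (auto simp: sum_nonneg)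
  also have "sum d ?B = sum ?w (set es)"
    by (intro sum.mono_neutral_cong_left) auto
  also have "\<dots> \<le> sum_list (map ?w es)"
    by (rule sum_set_le_sum_list) (use weight_nonneg in auto)
  finally show ?thesis unfolding loss_def by simp
qed

end

section \<open>The supermartingale\<close>

text \<open>One round as a transition kernel, so that expectations can be taken conditionally on the
  preceding state.\<close>

definition sos_step ::
  "nat \<Rightarrow> nat \<Rightarrow> strategy \<Rightarrow> nat \<Rightarrow> (nat \<Rightarrow> nat set) \<times> nat set \<times> nat \<Rightarrow>
    ((nat \<Rightarrow> nat set) \<times> nat set \<times> nat) pmf" where
  "sos_step k n s i = (\<lambda>(A, R, t).
     case s R t of
       Special e \<Rightarrow> return_pmf (A(i := {e}), R - {e}, t + 1)
     | Non_Special \<beta> \<Rightarrow> do {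
         es \<leftarrow> sample_round (k * (n - t)) \<beta> R [];
         return_pmf (A(i := set es), R - set es, t)
       })"

lemma sos_rounds_Suc:
  "sos_rounds k n m \<sigma> (Suc i) = sos_rounds k n m \<sigma> i \<bind> sos_step k n (\<sigma> (Suc i)) (Suc i)"
  by (simp add: sos_step_def)

declare sos_rounds.simps(2) [simp del]

lemma sos_rounds_support:
  "(A, R, t) \<in> set_pmf (sos_rounds k n m \<sigma> i) \<Longrightarrow> t \<le> i \<and> R \<subseteq> {1..m}"
proof (induction i arbitrary: A R t)
  case 0
  then show ?case by simp
next
  case (Suc i)
  from Suc.prems obtain A' R' t' where prev: "(A', R', t') \<in> set_pmf (sos_rounds k n m \<sigma> i)"
    and step: "(A, R, t) \<in> set_pmf (sos_step k n (\<sigma> (Suc i)) (Suc i) (A', R', t'))"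
    unfolding sos_rounds_Suc by auto
  from Suc.IH[OF prev] have IH: "t' \<le> i" "R' \<subseteq> {1..m}" by auto
  from step have "R \<subseteq> R' \<and> t \<le> Suc t'"
    unfolding sos_step_def by (auto split: action.splits)
  with IH show ?case by auto
qed

text \<open>Later rounds write only their own entries, so the bundle of agent \<open>i\<close> can
  be analysed right after round \<open>i\<close>.\<close>

lemma allocation_persists:
  "i \<le> j \<Longrightarrow>
    map_pmf (\<lambda>x. fst x i) (sos_rounds k n m \<sigma> j) = map_pmf (\<lambda>x. fst x i) (sos_rounds k n m \<sigma> i)"
proof (induction j rule: dec_induct)
  case base
  show ?case by simp
next
  case (step j)
  have "map_pmf (\<lambda>x. fst x i) (sos_step k n (\<sigma> (Suc j)) (Suc j) x) = return_pmf (fst x i)" for x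
    using step.hyps
    by (cases x) (auto simp: sos_step_def map_bind_pmf split: action.split)
  then have "map_pmf (\<lambda>x. fst x i) (sos_rounds k n m \<sigma> (Suc j))
      = sos_rounds k n m \<sigma> j \<bind> (\<lambda>x. return_pmf (fst x i))"
    unfolding sos_rounds_Suc by (simp add: map_bind_pmf)
  also have "\<dots> = map_pmf (\<lambda>x. fst x i) (sos_rounds k n m \<sigma> j)"
    by (simp add: map_pmf_def)
  finally show ?case using step.IH by simp
qed

text \<open>Up to taking eighth roots this is \<open>exp 8 \<le> 5 ^ 5\<close>, which already
  follows from \<open>exp 1 < 2.72\<close>.\<close>

lemma exp_1_le: "exp 1 \<le> exp (5/8 * ln (5::real))"
proof -
  have "exp (8::real) = exp 1 ^ 8" by (simp flip: exp_of_nat_mult)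
  also have "\<dots> \<le> (272/100) ^ 8" using e_less_272 by (intro power_mono) auto
  also have "\<dots> \<le> 5 ^ 5" by (simp add: power_numeral_reduce)
  also have "\<dots> = exp (5 * ln (5::real))" by (simp add: exp_of_nat_mult[of 5, simplified])
  finally have "8 \<le> 5 * ln (5::real)" by simp
  then show ?thesis by simp
qed

context bundle_weights
begin

text \<open>The difference \<open>real i - real t\<close> is the number of non-special rounds among
  the first \<open>i\<close>. It is taken in the reals because \<open>t \<le> i\<close> is not known
  for an arbitrary state.\<close>

definition potential :: "nat \<Rightarrow> nat set \<Rightarrow> nat \<Rightarrow> real" where
  "potential i R t = exp (ln 5 * (min_loss R t - 5/8 * (real i - real t)))"

text \<open>The expected loss of the minimising family in a non-special round is at most \<open>1/4\<close>, which
  costs a factor \<open>exp ((5 - 1) / 4)\<close>; the counter pays for it with \<open>5 powr (5/8)\<close>.\<close>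

lemma potential_step:
  assumes t: "t < n"
  shows "(\<integral>\<^sup>+ x. ennreal (potential (Suc i) (fst (snd x)) (snd (snd x)))
      \<partial>measure_pmf (sos_step 4 n s j (A, R, t))) \<le> ennreal (potential i R t)"
proof (cases "s R t")
  case (Special e)
  \<comment> \<open>Both counters rise by one, so the number of non-special rounds is
    unchanged.\<close>
  have "potential (Suc i) (R - {e}) (t + 1) \<le> potential i R t"
    unfolding potential_def using min_loss_remove[OF t, of R e] by simp
  with Special show ?thesis by (simp add: sos_step_def ennreal_leI)
next
  case (Non_Special \<beta>)
  \<comment> \<open>\<open>H\<close> is fixed before the draws and stays a candidate after them, so
    its new loss bounds the new minimum.\<close>
  obtain H where H: "H \<subseteq> {1..n}" "card H = n - t" "min_loss R t = loss H R"
    by (rule min_loss_attained)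
  define w where "w = (\<lambda>e. if e \<in> {1..m} \<and> own e \<in> H then d e else 0)"
  have w: "0 \<le> w e" "w e \<le> 1" for e using weight_nonneg weight_le_1 by (auto simp: w_def)
  let ?C = "loss H R - 5/8 * (real (Suc i) - real t)"
  let ?b = "4 * (n - t)"
  have "(\<integral>\<^sup>+ x. ennreal (potential (Suc i) (fst (snd x)) (snd (snd x)))
      \<partial>measure_pmf (sos_step 4 n s j (A, R, t)))
    = (\<integral>\<^sup>+ es. ennreal (potential (Suc i) (R - set es) t) \<partial>measure_pmf (sample_round ?b \<beta> R []))"
    using Non_Special by (simp add: sos_step_def)
  also have "\<dots> \<le> (\<integral>\<^sup>+ es. ennreal (exp (ln 5 * ?C)) * ennreal (exp (ln 5 * sum_list (map w es)))
      \<partial>measure_pmf (sample_round ?b \<beta> R []))"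
  proof (rule nn_integral_mono)
    fix es
    have "min_loss (R - set es) t \<le> loss H (R - set es)" by (rule min_loss_le) (use H in auto)
    also have "\<dots> \<le> loss H R + sum_list (map w es)" unfolding w_def by (rule loss_diff_le)
    finally have "min_loss (R - set es) t - 5/8 * (real (Suc i) - real t)
      \<le> ?C + sum_list (map w es)" by simp
    then have "potential (Suc i) (R - set es) t \<le> exp (ln 5 * (?C + sum_list (map w es)))"
      unfolding potential_def by simp
    then show "ennreal (potential (Suc i) (R - set es) t)
        \<le> ennreal (exp (ln 5 * ?C)) * ennreal (exp (ln 5 * sum_list (map w es)))"
      by (subst ennreal_mult[symmetric]) (auto intro!: ennreal_leI simp: distrib_left exp_add)
  qed
  also have "\<dots> = ennreal (exp (ln 5 * ?C)) *
      (\<integral>\<^sup>+ es. ennreal (exp (ln 5 * sum_list (map w es))) \<partial>measure_pmf (sample_round ?b \<beta> R []))"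
    by (rule nn_integral_cmult) simp
  also have "\<dots> \<le> ennreal (exp (ln 5 * ?C)) *
      ennreal (exp (ln 5 * sum_list (map w []) + (exp (ln 5) - 1) / real ?b * sum w R))"
    by (intro mult_left_mono nn_integral_sample_round_le w) auto
  also have "\<dots> \<le> ennreal (exp (ln 5 * ?C)) * ennreal (exp 1)"
  proof (intro mult_left_mono ennreal_leI)
    have "sum w R \<le> real (n - t)"
    \<comment> \<open>\<open>R\<close> is arbitrary here; over an infinite set the sum defaults to
      0.\<close>
    proof (cases "finite R")
      case True
      then have "sum w R = sum d {e\<in>R. e \<in> {1..m} \<and> own e \<in> H}"
        unfolding w_def by (intro sum.mono_neutral_cong_right) auto
      also have "\<dots> \<le> sum d {e\<in>{1..m}. own e \<in> H}"
        by (rule sum_mono2) (use weight_nonneg in auto)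
      also have "\<dots> \<le> real (n - t)" using sum_weight_le_card[OF H(1)] H(2) by simp
      finally show ?thesis .
    qed simp
    \<comment> \<open>Base 5 gives \<open>exp (ln 5) - 1 = 4\<close>. This cancels the factor 4 of
      the bucket size, and the total charge \<open>n - t\<close> cancels the rest.\<close>
    then have "4 / real ?b * sum w R \<le> 1" using t by (simp add: field_simps)
    then show "exp (ln 5 * sum_list (map w []) + (exp (ln 5) - 1) / real ?b * sum w R) \<le> exp 1"
      by simp
  qed simp
  also have "\<dots> \<le> ennreal (exp (ln 5 * ?C)) * ennreal (exp (5/8 * ln 5))"
    by (intro mult_left_mono ennreal_leI exp_1_le) simp
  \<comment> \<open>The factor \<open>exp (5/8 * ln 5)\<close> turns \<open>Suc i\<close> in
    \<open>?C\<close> back into \<open>i\<close>.\<close>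
  also have "\<dots> = ennreal (potential i R t)"
    unfolding potential_def H(3)
    by (subst ennreal_mult[symmetric]) (auto simp: exp_add[symmetric] field_simps)
  finally show ?thesis .
qed

lemma nn_integral_potential_le_1:
  "i \<le> n \<Longrightarrow> (\<integral>\<^sup>+ x. ennreal (potential i (fst (snd x)) (snd (snd x)))
      \<partial>measure_pmf (sos_rounds 4 n m \<sigma> i)) \<le> 1"
proof (induction i)
  case 0
  have "potential 0 {1..m} 0 \<le> 1" unfolding potential_def using min_loss_initial
    by (simp add: mult_nonneg_nonpos)
  then show ?case by simp
next
  case (Suc i)
  have "(\<integral>\<^sup>+ x. ennreal (potential (Suc i) (fst (snd x)) (snd (snd x)))
      \<partial>measure_pmf (sos_rounds 4 n m \<sigma> (Suc i)))
    = (\<integral>\<^sup>+ y. (\<integral>\<^sup>+ x. ennreal (potential (Suc i) (fst (snd x)) (snd (snd x)))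
      \<partial>measure_pmf (sos_step 4 n (\<sigma> (Suc i)) (Suc i) y)) \<partial>measure_pmf (sos_rounds 4 n m \<sigma> i))"
    unfolding sos_rounds_Suc by simp
  also have "\<dots> \<le> (\<integral>\<^sup>+ y. ennreal (potential i (fst (snd y)) (snd (snd y)))
      \<partial>measure_pmf (sos_rounds 4 n m \<sigma> i))"
  proof (rule nn_integral_mono_AE, unfold AE_measure_pmf_iff, rule ballI)
    fix y assume y: "y \<in> set_pmf (sos_rounds 4 n m \<sigma> i)"
    obtain A R t where [simp]: "y = (A, R, t)" by (cases y)
    \<comment> \<open>At most one special round per agent, so \<open>t \<le> i < n\<close>.\<close>
    have "t < n" using sos_rounds_support y Suc.prems by fastforce
    then show "(\<integral>\<^sup>+ x. ennreal (potential (Suc i) (fst (snd x)) (snd (snd x)))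
      \<partial>measure_pmf (sos_step 4 n (\<sigma> (Suc i)) (Suc i) y))
      \<le> ennreal (potential i (fst (snd y)) (snd (snd y)))"
      using potential_step by simp
  qed
  also have "\<dots> \<le> 1" using Suc by simp
  finally show ?case .
qed

text \<open>The \<open>n - t\<close> least charged bundles retain at least
  \<open>3/8 * (n - t)\<close> in total. By submodularity this total is at most
  \<open>(n - t) * v S\<close> plus the marginals of the items of \<open>R\<close> over the received
  set \<open>S\<close>, and the greedy buckets bound those by
  \<open>4 * (n - t) * (1/24 + v S)\<close>.\<close>

lemma non_special_value:
  assumes mono: "monotone_valuation m v" and submod: "submodular_valuation m v"
    and retained: "\<And>l R. l \<in> {1..n} \<Longrightarrow> R \<subseteq> {1..m} \<Longrightarrow>
      1 - sum d {e\<in>{1..m} - R. own e = l} \<le> v {e\<in>R. own e = l}"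
    and R: "R \<subseteq> {1..m}" and t: "t < n" and small: "\<And>e. e \<in> R \<Longrightarrow> v {e} \<le> 1/24"
    and rule: "\<And>G es. G \<subseteq> R \<Longrightarrow> set es \<subseteq> R - G \<Longrightarrow> 4 * (n - t) \<le> card G \<Longrightarrow>
      top_bucket v (4 * (n - t)) G (set es) (\<beta> G es)"
    and es: "es \<in> set_pmf (sample_round (4 * (n - t)) \<beta> R [])"
    and min_loss: "min_loss R t \<le> 5/8 * real (n - t)"
  shows "1/24 \<le> v (set es)"
proof -
  let ?S = "set es" and ?s = "real (n - t)"
  have finR: "finite R" using R by (rule finite_subset) simp
  have S: "?S \<subseteq> {1..m}" using set_sample_round_subset[OF es] R by auto
  have v0: "0 \<le> v {}" using mono unfolding monotone_valuation_def by blast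
  have "(\<Sum>f\<in>R. marginal v ?S f) \<le> real (4 * (n - t)) * (1/24 + v ?S - v (set []))"
  proof (rule sample_round_sum_marginal_le[OF mono submod _ R rule es])
    \<comment> \<open>The first bucket has no predecessor; the threshold for special rounds bounds
      its marginals instead.\<close>
    show "marginal v (set []) f \<le> 1/24" if "f \<in> R" for f
      using small[OF that] v0 by (simp add: marginal_def)
  qed (use t in auto)
  also have "\<dots> \<le> real (4 * (n - t)) * (1/24 + v ?S)"
    using v0 by (intro mult_left_mono) auto
  finally have marg: "(\<Sum>f\<in>R. marginal v ?S f) \<le> 4 * ?s * (1/24 + v ?S)" by simp
  obtain H where H: "H \<subseteq> {1..n}" "card H = n - t" "min_loss R t = loss H R"
    by (rule min_loss_attained)
  have finH: "finite H" using H(1) by (rule finite_subset) simp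
  have "loss H R = (\<Sum>l\<in>H. sum d {e\<in>{1..m} - R. own e = l})"
  proof -
    have "{e\<in>{1..m} - R. own e \<in> H} = (\<Union>l\<in>H. {e\<in>{1..m} - R. own e = l})" by auto
    then show ?thesis unfolding loss_def
      using finH by (simp only:) (rule sum.UNION_disjoint, auto)
  qed
  then have "?s - loss H R = (\<Sum>l\<in>H. 1 - sum d {e\<in>{1..m} - R. own e = l})"
    using H by (simp add: sum_subtractf)
  also have "\<dots> \<le> (\<Sum>l\<in>H. v ?S + (\<Sum>e\<in>{e\<in>R. own e = l}. marginal v ?S e))"
  proof (rule sum_mono)
    fix l assume "l \<in> H"
    then have "1 - sum d {e\<in>{1..m} - R. own e = l} \<le> v {e\<in>R. own e = l}"
      using retained R H by blast
    also have "\<dots> \<le> v (?S \<union> {e\<in>R. own e = l})"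
    proof -
      have "?S \<union> {e\<in>R. own e = l} \<subseteq> {1..m}" using S R by blast
      then show ?thesis using mono unfolding monotone_valuation_def by blast
    qed
    also have "\<dots> \<le> v ?S + (\<Sum>e\<in>{e\<in>R. own e = l}. marginal v ?S e)"
      by (rule valuation_Un_le_sum_marginal[OF mono submod]) (use finR R S in auto)
    finally show "1 - sum d {e\<in>{1..m} - R. own e = l} \<le> \<dots>" .
  qed
  also have "\<dots> = ?s * v ?S + (\<Sum>l\<in>H. \<Sum>e\<in>{e\<in>R. own e = l}. marginal v ?S e)"
    using H by (simp add: sum.distrib)
  also have "(\<Sum>l\<in>H. \<Sum>e\<in>{e\<in>R. own e = l}. marginal v ?S e)
      = (\<Sum>e\<in>(\<Union>l\<in>H. {e\<in>R. own e = l}). marginal v ?S e)"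
    using finH finR by (subst sum.UNION_disjoint) auto
  also have "\<dots> \<le> (\<Sum>e\<in>R. marginal v ?S e)"
  proof (rule sum_mono2[OF finR])
    show "0 \<le> marginal v ?S e" if "e \<in> R - (\<Union>l\<in>H. {e\<in>R. own e = l})" for e
      by (rule marginal_nonneg[OF mono S]) (use that R in blast)
  qed auto
  finally have "?s - loss H R \<le> ?s * v ?S + 4 * ?s * (1/24 + v ?S)" using marg by simp
  then have "?s * (3/8) \<le> ?s * (v ?S + 4 * (1/24 + v ?S))"
    using min_loss H(3) by (simp add: algebra_simps)
  moreover have "0 < ?s" using t by simp
  \<comment> \<open>Here \<open>3/8 - 4/24 = 5/24\<close>, and five copies of \<open>v ?S\<close>
    must cover it: exactly \<open>1/24\<close> each.\<close>
  ultimately have "3/8 \<le> v ?S + 4 * (1/24 + v ?S)" by (simp only: mult_le_cancel_left_pos)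
  then show ?thesis by simp
qed

end

section \<open>Failure probability of one agent, and the union bound over all agents\<close>

text \<open>A Markov argument. Given the state after \<open>i\<close> rounds, agent
  \<open>Suc i\<close> surely succeeds if the least loss is at most \<open>5/8 * (n - t)\<close>;
  otherwise the potential times the claimed bound is at least 1. The expected potential is at most
  1. The exponent \<open>n - i\<close> counts the agents from \<open>Suc i\<close> on.\<close>

lemma failure_probability_le:
  assumes i: "i < n" and mono: "monotone_valuation m v" and submod: "submodular_valuation m v"
    and MMS: "MMS n m v = 1" and safe: "safe_strategy 6 4 n m v (\<sigma> (Suc i))"
  shows "emeasure (measure_pmf (sos_rounds 4 n m \<sigma> (Suc i))) {x. v (fst x (Suc i)) < 1/24}
    \<le> ennreal (exp (- (5/8 * ln 5)) ^ (n - i))"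
proof -
  obtain own d where "bundle_weights n m own d"
    and retained: "\<And>l R. l \<in> {1..n} \<Longrightarrow> R \<subseteq> {1..m} \<Longrightarrow>
      1 - sum d {e\<in>{1..m} - R. own e = l} \<le> v {e\<in>R. own e = l}"
    using MMS_bundle_weights[OF _ mono submod MMS] i by auto
  interpret bundle_weights n m own d by fact
  let ?fail = "{x. v (fst x (Suc i)) < 1/24}"
  let ?\<rho> = "exp (- (5/8 * ln (5::real))) ^ (n - i)"
  have step: "emeasure (measure_pmf (sos_step 4 n (\<sigma> (Suc i)) (Suc i) (A, R, t))) ?fail
      \<le> ennreal (potential i R t) * ennreal ?\<rho>" if "t < n" "R \<subseteq> {1..m}" for A R t
  proof (cases "min_loss R t \<le> 5/8 * real (n - t)")
    case True
    have c: "1 / (6 * real 4) = (1/24 :: real)" by simp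
    note action = safe[unfolded safe_strategy_def c, THEN spec, THEN mp, OF \<open>R \<subseteq> {1..m}\<close>,
      THEN spec, THEN mp, OF \<open>t < n\<close>]
    have "1/24 \<le> v (fst x (Suc i))"
      if x: "x \<in> set_pmf (sos_step 4 n (\<sigma> (Suc i)) (Suc i) (A, R, t))" for x
    proof (cases "\<exists>e\<in>R. 1/24 \<le> v {e}")
      case True
      with action obtain e where "\<sigma> (Suc i) R t = Special e" "\<forall>f\<in>R. v {f} \<le> v {e}"
        by (simp only: if_True) blast
      with True have "\<sigma> (Suc i) R t = Special e" "1/24 \<le> v {e}" by (blast intro: order_trans)+
      with x show ?thesis by (simp add: sos_step_def)
    next
      case False
      with action obtain \<beta> where \<beta>: "\<sigma> (Suc i) R t = Non_Special \<beta>"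
        and rule: "\<And>G es. G \<subseteq> R \<Longrightarrow> set es \<subseteq> R - G \<Longrightarrow> 4 * (n - t) \<le> card G \<Longrightarrow>
           top_bucket v (4 * (n - t)) G (set es) (\<beta> G es)"
        by (simp only: if_False) blast
      from x \<beta> obtain es where es: "es \<in> set_pmf (sample_round (4 * (n - t)) \<beta> R [])"
        and "fst x (Suc i) = set es" by (auto simp: sos_step_def)
      moreover have "1/24 \<le> v (set es)"
        by (rule non_special_value[OF mono submod retained \<open>R \<subseteq> {1..m}\<close> \<open>t < n\<close> _ rule es])
          (use False \<open>min_loss R t \<le> _\<close> in \<open>auto simp: not_le less_imp_le\<close>)
      ultimately show ?thesis by simp
    qed
    then have "emeasure (measure_pmf (sos_step 4 n (\<sigma> (Suc i)) (Suc i) (A, R, t))) ?fail = 0"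
      using emeasure_eq_0_AE[of "\<lambda>x. v (fst x (Suc i)) < 1/24"
          "measure_pmf (sos_step 4 n (\<sigma> (Suc i)) (Suc i) (A, R, t))"]
      by (simp add: AE_measure_pmf_iff not_less)
    then show ?thesis by simp
  next
    case False
    \<comment> \<open>In the reals \<open>n - t = (n - i) + (i - t)\<close>, and
      \<open>i - t\<close> is the counter inside the potential.\<close>
    then have large: "5/8 * real (n - i) \<le> min_loss R t - 5/8 * (real i - real t)"
      using \<open>t < n\<close> i by (simp add: of_nat_diff field_simps)
    have "1 = exp (ln 5 * (5/8 * real (n - i))) * ?\<rho>"
      by (simp add: exp_of_nat_mult[symmetric] exp_add[symmetric] algebra_simps)
    also have "\<dots> \<le> potential i R t * ?\<rho>"
      unfolding potential_def using large
      by (intro mult_right_mono iffD2[OF exp_le_cancel_iff] mult_left_mono) auto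
    finally have "ennreal 1 \<le> ennreal (potential i R t * ?\<rho>)" by (rule ennreal_leI)
    then have "1 \<le> ennreal (potential i R t) * ennreal ?\<rho>"
      by (simp add: ennreal_mult potential_def)
    then show ?thesis using measure_pmf.emeasure_le_1 order_trans by blast
  qed
  have "emeasure (measure_pmf (sos_rounds 4 n m \<sigma> (Suc i))) ?fail
    = (\<integral>\<^sup>+ y. emeasure (measure_pmf (sos_step 4 n (\<sigma> (Suc i)) (Suc i) y)) ?fail
        \<partial>measure_pmf (sos_rounds 4 n m \<sigma> i))"
    unfolding sos_rounds_Suc by simp
  also have "\<dots> \<le> (\<integral>\<^sup>+ y. ennreal (potential i (fst (snd y)) (snd (snd y))) * ennreal ?\<rho>
        \<partial>measure_pmf (sos_rounds 4 n m \<sigma> i))"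
  proof (rule nn_integral_mono_AE, unfold AE_measure_pmf_iff, rule ballI)
    fix y assume y: "y \<in> set_pmf (sos_rounds 4 n m \<sigma> i)"
    obtain A R t where [simp]: "y = (A, R, t)" by (cases y)
    have "t < n" "R \<subseteq> {1..m}" using sos_rounds_support[of A R t 4 n m \<sigma> i] y i by auto
    then show "emeasure (measure_pmf (sos_step 4 n (\<sigma> (Suc i)) (Suc i) y)) ?fail
        \<le> ennreal (potential i (fst (snd y)) (snd (snd y))) * ennreal ?\<rho>"
      using step by simp
  qed
  also have "\<dots> = (\<integral>\<^sup>+ y. ennreal (potential i (fst (snd y)) (snd (snd y)))
        \<partial>measure_pmf (sos_rounds 4 n m \<sigma> i)) * ennreal ?\<rho>"
    by (rule nn_integral_multc) simp
  also have "\<dots> \<le> 1 * ennreal ?\<rho>"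
    using i by (intro mult_right_mono nn_integral_potential_le_1) auto
  finally show ?thesis by simp
qed

text \<open>The constant lies between \<open>5 powr (- 5/8)\<close> and \<open>577/1577\<close>, the
  largest \<open>q\<close> with \<open>q / (1 - q) \<le> 0.577\<close>. Eighth powers make the
  comparison rational.\<close>

lemma exp_neg_le: "exp (- (5/8 * ln (5::real))) \<le> 36585 / 100000"
proof (rule power_le_imp_le_base)
  have "exp (- (5/8 * ln (5::real))) ^ 8 = exp (- (5 * ln 5))"
    by (simp flip: exp_of_nat_mult)
  also have "\<dots> = 1 / 5 ^ 5"
    by (simp add: exp_minus exp_of_nat_mult[of 5, simplified] divide_simps)
  also have "\<dots> \<le> (36585 / 100000) ^ 8" by (simp add: power_numeral_reduce)
  finally show "exp (- (5/8 * ln (5::real))) ^ Suc 7 \<le> (36585 / 100000) ^ Suc 7" by simp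
qed simp

text \<open>Read backwards, the sum is a geometric one; \<open>q\<close> replaces \<open>r\<close>
  so that the final estimate is numeric.\<close>

lemma sum_power_rev_le:
  fixes r q :: real
  assumes "0 \<le> r" "r \<le> q" "q < 1"
  shows "(\<Sum>i<n. r ^ (n - i)) \<le> q / (1 - q)"
proof -
  have "(\<Sum>i<n. r ^ (n - i)) = (\<Sum>i<n. r ^ Suc i)"
    by (rule sum.reindex_bij_witness[of _ "\<lambda>i. n - Suc i" "\<lambda>i. n - Suc i"])
      (auto simp: Suc_diff_Suc simp flip: power_Suc)
  also have "\<dots> \<le> (\<Sum>i<n. q ^ Suc i)"
    using assms by (intro sum_mono power_mono) auto
  also have "\<dots> = q * (\<Sum>i<n. q ^ i)" by (simp add: sum_distrib_left)
  also have "\<dots> = q * ((1 - q ^ n) / (1 - q))" using assms by (subst sum_gp_strict) auto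
  also have "\<dots> \<le> q * (1 / (1 - q))"
    using assms by (intro mult_left_mono divide_right_mono) auto
  finally show ?thesis by simp
qed

theorem corollary5p2:
  "\<exists>(c::real) (k::nat). c > 0 \<and> k > 0 \<and>
     (\<forall>(n::nat) (m::nat) (v :: nat \<Rightarrow> nat set \<Rightarrow> real) (\<sigma> :: nat \<Rightarrow> strategy).
        n \<ge> 1 \<and>
        (\<forall>i\<in>{1..n}. monotone_valuation m (v i) \<and> submodular_valuation m (v i) \<and>
           MMS n m (v i) = 1 \<and> safe_strategy c k n m (v i) (\<sigma> i)) \<longrightarrow>
        competitive (1 / 24) 0.423 n m v (single_or_sample k n m \<sigma>))"
proof (intro exI conjI allI impI)
  fix n m :: nat and v :: "nat \<Rightarrow> nat set \<Rightarrow> real" and \<sigma> :: "nat \<Rightarrow> strategy"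
  \<comment> \<open>\<open>exI\<close> leaves the parameters schematic; this assumption and the
    final \<open>show\<close> fix them to \<open>c = 6\<close> and \<open>k = 4\<close>.\<close>
  assume asm: "n \<ge> 1 \<and>
        (\<forall>i\<in>{1..n}. monotone_valuation m (v i) \<and> submodular_valuation m (v i) \<and>
           MMS n m (v i) = 1 \<and> safe_strategy 6 4 n m (v i) (\<sigma> i))"
  let ?D = "single_or_sample 4 n m \<sigma>"
  let ?fail = "\<lambda>i. {A. v (Suc i) (A (Suc i)) < 1/24}"
  let ?good = "{A. \<forall>i\<in>{1..n}. 1/24 * MMS n m (v i) \<le> v i (A i)}"
  let ?r = "exp (- (5/8 * ln (5::real)))"
  have fail: "measure_pmf.prob ?D (?fail i) \<le> ?r ^ (n - i)" if "i < n" for i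
  proof -
    let ?X = "{S. v (Suc i) S < 1/24}"
    have "emeasure (measure_pmf ?D) (?fail i)
        = emeasure (measure_pmf (map_pmf (\<lambda>x. fst x (Suc i)) (sos_rounds 4 n m \<sigma> n))) ?X"
      by (simp add: single_or_sample_def vimage_def)
    also have "\<dots> =
        emeasure (measure_pmf (map_pmf (\<lambda>x. fst x (Suc i)) (sos_rounds 4 n m \<sigma> (Suc i)))) ?X"
      using that by (subst allocation_persists[of "Suc i" n]) auto
    also have "\<dots> = emeasure (measure_pmf (sos_rounds 4 n m \<sigma> (Suc i)))
        {x. v (Suc i) (fst x (Suc i)) < 1/24}"
      by (simp add: vimage_def)
    also have "\<dots> \<le> ennreal (?r ^ (n - i))"
      by (rule failure_probability_le) (use that asm in auto)
    finally show ?thesis by (simp add: measure_pmf.emeasure_eq_measure)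
  qed
  have "UNIV - ?good = (\<Union>i\<in>{..<n}. ?fail i)"
  proof -
    have "?good = {A. \<forall>i\<in>{1..n}. 1/24 \<le> v i (A i)}" using asm by auto
    \<comment> \<open>Agents are shifted to start at 0, matching the indices of
      \<open>?fail\<close>.\<close>
    also have "\<dots> = {A. \<forall>i\<in>{..<n}. 1/24 \<le> v (Suc i) (A (Suc i))}"
      unfolding image_Suc_lessThan[symmetric] by (simp only: ball_simps)
    finally have good: "?good = {A. \<forall>i\<in>{..<n}. 1/24 \<le> v (Suc i) (A (Suc i))}" .
    show ?thesis unfolding good by (auto simp: not_le Ball_def)
  qed
  \<comment> \<open>The union bound is safe although the failures of different agents may be
    dependent.\<close>
  then have "measure_pmf.prob ?D (UNIV - ?good) \<le> (\<Sum>i<n. measure_pmf.prob ?D (?fail i))"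
    by (simp add: measure_pmf.finite_measure_subadditive_finite)
  also have "\<dots> \<le> (\<Sum>i<n. ?r ^ (n - i))" by (rule sum_mono) (use fail in auto)
  also have "\<dots> \<le> (36585 / 100000) / (1 - 36585 / 100000)"
    by (rule sum_power_rev_le) (use exp_neg_le in auto)
  also have "\<dots> \<le> 0.577" by simp
  finally have "measure_pmf.prob ?D (UNIV - ?good) \<le> 0.577" .
  moreover have "measure_pmf.prob ?D (UNIV - ?good) = 1 - measure_pmf.prob ?D ?good"
    using measure_pmf.prob_compl[of ?good ?D] by simp
  ultimately show "competitive (1 / 24) 0.423 n m v ?D"
    unfolding competitive_def by simp
qed auto

end
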